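(* Let $n\in\mathbb{N}$ and let $b,c\in\mathbb{R}$ with $b,c\notin\{0,-1,\dots,-n+1\}$. Then ${}_2F_1(-n,b;c;z)$ has all its zeros real and simple, and $(n-2)$ of them lie in (i) $(0,1)$ for $-1<c<0$ and $c+n-2<b<c+n-1$; one of the remaining zeros lies in $(1,\infty)$ and the other one in $(-\infty,0)$. (ii) $(1,\infty)$ for $1-n<b<2-n$ and $b-n+1<c<b-n+2$; one of the remaining zeros lies in $(-\infty,0)$ and the other one in $(0,1)$. (iii) $(-\infty,0)$ for $-1<c<0$ and $1-n<b<2-n$; one of the remaining zeros lies in $(1,\infty)$ and the other one in $(0,1)$.
   Context: For $n\in\mathbb{N}$ and real $b,c$ with $c\notin\{0,-1,\dots,-n+1\}$, the hypergeometric polynomial is ${}_2F_1(-n,b;c;z)=\sum_{k=0}^{n}\frac{(-n)_k(b)_k}{(c)_k}\frac{z^k}{k!}$, where $(\alpha)_0=1$ and $(\alpha)_k=\alpha(\alpha+1)\cdots(\alpha+k-1)$ for $k\ge1$. The condition $b\notin\{0,-1,\dots,-n+1\}$ ensures that it has degree exactly $n$. The assertion about reality and simplicity of the zeros is made for the parameter ranges listed in (i), (ii) and (iii).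
   Formalization: Assumes n ≥ 2, since n−2 zeros plus two others is meaningless for smaller n. For n = 2 it also requires b > 0 in (i), c < −1 in (ii), and b < c in (iii); otherwise the claim is false (e.g. n = 2, b = −1/4, c = −3/4 gives no real zeros). Unchanged for n ≥ 3. *)

theory Defs
  imports Complex_Main "HOL-Computational_Algebra.Computational_Algebra"
begin

(* Division is total with x / 0 = 0, so the coefficients are the intended ones only when
   pochhammer c k is nonzero for all k \<le> n, i.e. c is none of 0, -1, ..., -n+1. *)
definition hyp2F1_poly :: "nat \<Rightarrow> 'a :: field_char_0 \<Rightarrow> 'a \<Rightarrow> 'a poly" where
  "hyp2F1_poly n b c =
     (\<Sum>k\<le>n. monom (pochhammer (- of_nat n) k * pochhammer b k / (pochhammer c k * fact k)) k)"

lemma poly_hyp2F1_poly: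
  "poly (hyp2F1_poly n b c) z =
     (\<Sum>k\<le>n. pochhammer (- of_nat n) k * pochhammer b k / pochhammer c k * (z ^ k / fact k))"
  by (simp add: hyp2F1_poly_def poly_sum poly_monom)

lemma coeff_hyp2F1_poly:
  "coeff (hyp2F1_poly n b c) k =
     (if k \<le> n then pochhammer (- of_nat n) k * pochhammer b k / (pochhammer c k * fact k) else 0)"
  by (simp add: hyp2F1_poly_def coeff_sum)

lemma fps_of_poly_hyp2F1_poly:
  "fps_of_poly (hyp2F1_poly n b c) = fps_hypergeo [- of_nat n, b] [c] 1"
  by (rule fps_ext) (simp add: coeff_hyp2F1_poly pochhammer_of_nat_eq_0_iff)

definition lower_nonpos_ints :: "nat \<Rightarrow> real set" where
  "lower_nonpos_ints n = (\<lambda>k. - real k) ` {..<n}"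

lemma degree_hyp2F1_poly:
  assumes "b \<notin> lower_nonpos_ints n" and "c \<notin> lower_nonpos_ints n"
  shows "degree (hyp2F1_poly n b c) = n"
proof (rule antisym)
  show "degree (hyp2F1_poly n b c) \<le> n"
    by (rule degree_le) (simp add: coeff_hyp2F1_poly)
  have "pochhammer a n \<noteq> 0" if "a \<notin> lower_nonpos_ints n" for a
    using that by (auto simp: lower_nonpos_ints_def pochhammer_eq_0_iff)
  moreover have "pochhammer (- real n) n \<noteq> 0"
    by (simp add: pochhammer_of_nat_eq_0_iff)
  ultimately have "coeff (hyp2F1_poly n b c) n \<noteq> 0"
    using assms by (simp add: coeff_hyp2F1_poly)
  then show "n \<le> degree (hyp2F1_poly n b c)"
    by (rule le_degree)
qed

definition zeros_real_simple :: "real poly \<Rightarrow> bool" where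
  "zeros_real_simple p \<longleftrightarrow>
     (\<forall>z. poly (map_poly complex_of_real p) z = 0 \<longrightarrow>
        z \<in> \<real> \<and> order z (map_poly complex_of_real p) = 1)"

(* Zeros are counted without multiplicity; used together with zeros_real_simple. *)
definition num_zeros_in :: "real poly \<Rightarrow> real set \<Rightarrow> nat" where
  "num_zeros_in p S = card {x \<in> S. poly p x = 0}"

end

theory Submission
  imports Defs
begin

text \<open>
  Put P = F(-k, b+1; c+1; z) and f(z) = z^c (1-z)^(b-c-k) P(z). The derivative of f is
  c z^(c-1) (1-z)^(b-c-k-1) F(-k-1, b; c; z). When both exponents of f are positive, f also
  vanishes at 0 and 1, so by Rolle each such step gains a zero in (0,1). Hence F(-k, b; c; z)
  has k zeros in (0,1) when c > 0 and b > c + k - 1. In case (i) this yields n - 1 zeros for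
  F(-n+1, b+1; c+1; z), and one more Rolle step, now with an exponent c < 0 and thus without the
  endpoints, leaves n - 2 zeros of F(-n, b; c; z). Each outer interval contributes a zero by the
  signs of the values at 0 and 1 (the latter by Chu-Vandermonde) and of the leading coefficient.
  So the degree n is exhausted by distinct real zeros. Case (ii) reduces to (i) by reversing the
  coefficients, z -> 1/z, and case (iii) by Pfaff's transformation z -> z/(z-1).
\<close>

section \<open>Coefficients and the derivative relation\<close>

lemma coeff_hyp2F1_poly':
  "coeff (hyp2F1_poly n b c) k = pochhammer (- of_nat n) k * pochhammer b k / (pochhammer c k * fact k)"
  by (simp add: coeff_hyp2F1_poly pochhammer_of_nat_eq_0_iff)

lemma hyp2F1_poly_nonzero [simp]: "hyp2F1_poly n b c \<noteq> 0"
proof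
  assume "hyp2F1_poly n b c = 0"
  then have "coeff (hyp2F1_poly n b c) 0 = 0" by simp
  then show False by (simp add: coeff_hyp2F1_poly')
qed

lemma pochhammer_nonzero:
  assumes "c \<notin> lower_nonpos_ints n" and "k \<le> n"
  shows "pochhammer c k \<noteq> 0"
  using assms by (auto simp: lower_nonpos_ints_def pochhammer_eq_0_iff)

text \<open>The derivative formula with the weight z^c (1-z)^(b-c-k) cancelled: the linear factor is
  c(1-z) - (b-c-k)z = c + (k-b)z. Comparing coefficients avoids any analysis and any sign condition
  on the exponents.\<close>

lemma hyp2F1_poly_raise:
  fixes b c :: real
  assumes "c \<notin> lower_nonpos_ints (Suc k)"
  defines "P \<equiv> hyp2F1_poly k (b + 1) (c + 1)"
  shows "[:0, 1, -1:] * pderiv P + [:c, real k - b:] * P = smult c (hyp2F1_poly (Suc k) b c)"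
proof (rule poly_eqI)
  fix i
  show "coeff ([:0, 1, -1:] * pderiv P + [:c, real k - b:] * P) i
      = coeff (smult c (hyp2F1_poly (Suc k) b c)) i"
  proof (cases i)
    case 0
    then show ?thesis by (simp add: P_def coeff_hyp2F1_poly')
  next
    case (Suc j)
    have lhs: "coeff ([:0, 1, -1:] * pderiv P + [:c, real k - b:] * P) (Suc j)
        = (c + 1 + j) * coeff P (Suc j) + (k - b - j) * coeff P j"
      by (cases j) (simp_all add: coeff_pderiv algebra_simps)
    show ?thesis
    proof (cases "j \<le> k")
      case False
      then show ?thesis
        unfolding Suc lhs by (simp add: P_def coeff_hyp2F1_poly)
    next
      case True
      have C: "pochhammer c (Suc j) \<noteq> 0"
        using pochhammer_nonzero[OF assms(1), of "Suc j"] True by simp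
      then have c0: "c \<noteq> 0" and C1: "pochhammer (c + 1) j \<noteq> 0"
        by (simp_all add: pochhammer_rec)
      have "(c + 1 + j) * coeff P (Suc j) = (real j - k) * (b + 1 + j) / (j + 1) * coeff P j"
      \<comment> \<open>For \<open>j = k\<close> both sides vanish. This case is separate because
        the hypothesis on \<open>c\<close> still allows \<open>c + 1 + k = 0\<close>.\<close>
      proof (cases "j = k")
        case True
        then show ?thesis by (simp add: P_def coeff_hyp2F1_poly)
      next
        case False
        then have "pochhammer c (Suc (Suc j)) \<noteq> 0"
          using pochhammer_nonzero[OF assms(1), of "Suc (Suc j)"] \<open>j \<le> k\<close> by simp
        then have "c + 1 + j \<noteq> 0" by (simp add: pochhammer_rec' add_ac)
        then show ?thesis
          by (simp add: P_def coeff_hyp2F1_poly' pochhammer_rec' [of _ j] divide_simps C1)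
      qed
      \<comment> \<open>Splitting off the first factor of each Pochhammer symbol leaves exactly
        those occurring in \<open>P\<close>.\<close>
      moreover have "c * coeff (hyp2F1_poly (Suc k) b c) (Suc j) = - (real k + 1) * b / (j + 1) * coeff P j"
        using c0 C1
        by (simp add: P_def coeff_hyp2F1_poly' pochhammer_rec [of _ j] divide_simps)
      moreover have "(real j - k) * (b + 1 + j) / (j + 1) * coeff P j + (k - b - j) * coeff P j
          = - (real k + 1) * b / (j + 1) * coeff P j"
        by (simp add: divide_simps) (simp add: algebra_simps)
      ultimately show ?thesis
        unfolding Suc lhs coeff_smult by (simp only:)
    qed
  qed
qed

section \<open>Rolle's theorem and zeros in the unit interval\<close>

text \<open>Bounding \<open>T\<close> by \<open>Max S\<close> carries the induction: a new largest
  point yields a zero of \<open>f'\<close> beyond the old maximum, hence outside \<open>T\<close>.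
  Differentiability is asked only in the open interval, so \<open>S\<close> may contain end points
  where a power is not differentiable.\<close>

lemma Rolle_finite:
  fixes f f' :: "real \<Rightarrow> real"
  assumes "finite S" "S \<noteq> {}" "S \<subseteq> {u..v}" "\<And>x. x \<in> S \<Longrightarrow> f x = 0"
    and "continuous_on {u..v} f"
    and "\<And>x. u < x \<Longrightarrow> x < v \<Longrightarrow> (f has_real_derivative f' x) (at x)"
  shows "\<exists>T \<subseteq> {u<..<Max S}. finite T \<and> Suc (card T) = card S \<and> (\<forall>x\<in>T. f' x = 0)"
  using assms(1-4)
proof (induction S rule: finite_linorder_max_induct)
  case empty
  then show ?case by simp
next
  case (insert y S)
  show ?case
  proof (cases "S = {}")
    case True
    then show ?thesis by (intro exI[of _ "{}"]) simp
  next
    case False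
    with insert obtain T where T: "T \<subseteq> {u<..<Max S}" "finite T" "Suc (card T) = card S"
        "\<forall>x\<in>T. f' x = 0"
      by auto
    let ?m = "Max S"
    have "?m \<in> S" using insert.hyps False by simp
    then have m: "?m \<in> S" "?m < y" "u \<le> ?m" "y \<le> v"
      using insert.hyps insert.prems by auto
    \<comment> \<open>\<open>Rolle_deriv\<close> gives the derivative as a linear map; its value at
      1 is \<open>f' z\<close>.\<close>
    have "\<exists>z. ?m < z \<and> z < y \<and> (*) (f' z) = (\<lambda>v. 0)"
    proof (rule Rolle_deriv)
      show "f ?m = f y" using insert.prems m by simp
      show "continuous_on {?m..y} f"
        by (rule continuous_on_subset[OF assms(5)]) (use m in auto)
      show "(f has_derivative (*) (f' x)) (at x)" if "?m < x" "x < y" for x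
        using assms(6)[of x] that m by (simp add: has_field_derivative_def)
    qed (use m in simp)
    then obtain z where z: "?m < z" "z < y" "f' z = 0"
      by (metis mult.right_neutral)
    have "Max (insert y S) = y"
      using insert.hyps by (intro Max_eqI) auto
    moreover have "y \<notin> S" using insert.hyps by blast
    moreover have "z \<notin> T" using T(1) z by auto
    ultimately show ?thesis
      using T z m insert.hyps
      by (intro exI[of _ "insert z T"]) auto
  qed
qed

lemma num_zeros_in_mono:
  assumes "q \<noteq> 0" "inj_on g {x \<in> S. poly p x = 0}"
    and "\<And>x. x \<in> S \<Longrightarrow> poly p x = 0 \<Longrightarrow> g x \<in> T \<and> poly q (g x) = 0"
  shows "num_zeros_in p S \<le> num_zeros_in q T"
  unfolding num_zeros_in_def
proof (rule card_inj_on_le[OF assms(2)])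
  show "finite {x \<in> T. poly q x = 0}"
    using poly_roots_finite[OF assms(1)] by (rule rev_finite_subset) auto
qed (use assms(3) in auto)

lemma num_zeros_in_ge:
  assumes "q \<noteq> 0" "Z \<subseteq> T" "\<And>x. x \<in> Z \<Longrightarrow> poly q x = 0"
  shows "card Z \<le> num_zeros_in q T"
  unfolding num_zeros_in_def
  by (rule card_mono) (use assms poly_roots_finite[OF assms(1)] in \<open>auto intro: rev_finite_subset\<close>)

text \<open>On (0,1) the function \<open>f\<close> below has the zeros of \<open>p\<close>, and its
  derivative is a positive weight times \<open>k * poly q x\<close>. The first bound uses inner
  points only, so it allows exponents of any sign.\<close>

lemma num_zeros_Rolle:
  fixes p q :: "real poly"
  assumes "p \<noteq> 0" "q \<noteq> 0"
    and q: "\<And>x. 0 < x \<Longrightarrow> x < 1 \<Longrightarrow>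
      k * poly q x = x * (1 - x) * poly (pderiv p) x + (\<alpha> * (1 - x) - \<beta> * x) * poly p x"
    and "k \<noteq> 0"
  shows "num_zeros_in p {0<..<1} \<le> Suc (num_zeros_in q {0<..<1})"
    and "0 < \<alpha> \<Longrightarrow> 0 < \<beta> \<Longrightarrow> Suc (num_zeros_in p {0<..<1}) \<le> num_zeros_in q {0<..<1}"
proof -
  define f where "f x = x powr \<alpha> * (1 - x) powr \<beta> * poly p x" for x :: real
  define f' where "f' x = x powr (\<alpha> - 1) * (1 - x) powr (\<beta> - 1) * (k * poly q x)" for x :: real
  have deriv: "(f has_real_derivative f' x) (at x)" if "0 < x" "x < 1" for x
  proof -
    have e: "x powr \<alpha> = x powr (\<alpha> - 1) * x" "(1 - x) powr \<beta> = (1 - x) powr (\<beta> - 1) * (1 - x)"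
      using that by (simp_all add: powr_mult_base mult.commute)
    have "(f has_real_derivative
        (\<alpha> * x powr (\<alpha> - 1) * (1 - x) powr \<beta> - x powr \<alpha> * (\<beta> * (1 - x) powr (\<beta> - 1))) * poly p x
        + x powr \<alpha> * (1 - x) powr \<beta> * poly (pderiv p) x) (at x)"
      unfolding f_def using that
      by (auto intro!: derivative_eq_intros simp: algebra_simps)
    then show ?thesis
      unfolding f'_def q[OF that] e by (simp add: algebra_simps)
  qed
  let ?Z = "{x \<in> {0<..<1}. poly p x = 0}"
  have fin: "finite ?Z"
    using poly_roots_finite[OF assms(1)] by (rule rev_finite_subset) auto
  have bound: "card S \<le> Suc (num_zeros_in q {0<..<1})"
    if "finite S" "S \<subseteq> {u..v}" "\<And>x. x \<in> S \<Longrightarrow> f x = 0" "continuous_on {u..v} f" "0 \<le> u" "v \<le> 1"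
    for S u v
  proof (cases "S = {}")
    case False
    have "\<exists>T \<subseteq> {u<..<Max S}. finite T \<and> Suc (card T) = card S \<and> (\<forall>x\<in>T. f' x = 0)"
      by (rule Rolle_finite[OF that(1) False that(2,3,4)]) (use that(5,6) in \<open>auto intro: deriv\<close>)
    then obtain T where T: "T \<subseteq> {u<..<Max S}" "Suc (card T) = card S" "\<forall>x\<in>T. f' x = 0"
      by blast
    have "Max S \<le> 1" using Max_in[OF that(1) False] that(2,6) by auto
    then have sub: "T \<subseteq> {0<..<1}" using T(1) that(5) by force
    then have "poly q x = 0" if "x \<in> T" for x
      using T(3) that \<open>k \<noteq> 0\<close> by (force simp: f'_def)
    then have "card T \<le> num_zeros_in q {0<..<1}"
      by (intro num_zeros_in_ge assms sub)
    then show ?thesis using T(2) by simp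
  qed simp
  show "num_zeros_in p {0<..<1} \<le> Suc (num_zeros_in q {0<..<1})"
  proof (cases "?Z = {}")
    case False
    have *: "Min ?Z \<in> ?Z" "Max ?Z \<in> ?Z" using Min_in[OF fin False] Max_in[OF fin False] by auto
    \<comment> \<open>Between the extreme zeros \<open>f\<close> stays away from 0 and 1, where a
      negative exponent would break continuity.\<close>
    have "continuous_on {Min ?Z..Max ?Z} f"
      by (intro continuous_at_imp_continuous_on ballI DERIV_isCont[OF deriv]) (use * in auto)
    then have "card ?Z \<le> Suc (num_zeros_in q {0<..<1})"
      by (intro bound[of ?Z "Min ?Z" "Max ?Z"]) (use * fin in \<open>auto simp: f_def\<close>)
    then show ?thesis by (simp add: num_zeros_in_def)
  next
    case True
    then show ?thesis unfolding num_zeros_in_def by (metis card.empty zero_le)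
  qed
  show "Suc (num_zeros_in p {0<..<1}) \<le> num_zeros_in q {0<..<1}" if "0 < \<alpha>" "0 < \<beta>"
  proof -
    \<comment> \<open>Since \<open>0 powr \<alpha> = 0\<close> for every \<open>\<alpha>\<close>,
      positivity of the exponents serves continuity at the end points. These add two zeros of
      \<open>f\<close>, and Rolle takes one back.\<close>
    have "continuous_on {0..1} f"
      unfolding f_def by (intro continuous_intros continuous_on_powr') (use that in auto)
    then have "card (insert 0 (insert 1 ?Z)) \<le> Suc (num_zeros_in q {0<..<1})"
      by (intro bound[of _ 0 1]) (use fin in \<open>auto simp: f_def\<close>)
    then show ?thesis using fin by (simp add: num_zeros_in_def)
  qed
qed

lemma hyp2F1_poly_Rolle:
  fixes b c :: real
  assumes "c \<notin> lower_nonpos_ints (Suc k)"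
  shows "num_zeros_in (hyp2F1_poly k (b + 1) (c + 1)) {0<..<1}
      \<le> Suc (num_zeros_in (hyp2F1_poly (Suc k) b c) {0<..<1})"
    and "0 < c \<Longrightarrow> c + real k < b \<Longrightarrow> Suc (num_zeros_in (hyp2F1_poly k (b + 1) (c + 1)) {0<..<1})
      \<le> num_zeros_in (hyp2F1_poly (Suc k) b c) {0<..<1}"
proof -
  let ?p = "hyp2F1_poly k (b + 1) (c + 1)" and ?q = "hyp2F1_poly (Suc k) b c"
  have c0: "c \<noteq> 0" using assms by (force simp: lower_nonpos_ints_def)
  have eq: "c * poly ?q x = x * (1 - x) * poly (pderiv ?p) x + (c * (1 - x) - (b - c - k) * x) * poly ?p x"
    for x
    using arg_cong[OF hyp2F1_poly_raise[OF assms, of b], of "\<lambda>p. poly p x"]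
    by (simp add: algebra_simps)
  show "num_zeros_in ?p {0<..<1} \<le> Suc (num_zeros_in ?q {0<..<1})"
    by (rule num_zeros_Rolle(1)[OF _ _ eq c0]) simp_all
  show "Suc (num_zeros_in ?p {0<..<1}) \<le> num_zeros_in ?q {0<..<1}" if "0 < c" "c + real k < b"
    by (rule num_zeros_Rolle(2)[OF _ _ eq c0]) (use that in simp_all)
qed

text \<open>Going from \<open>Suc k\<close> down to \<open>k\<close> raises \<open>b\<close> and
  \<open>c\<close> together, so b - c is unchanged and the hypotheses persist; each step back up
  gains one zero.\<close>

lemma hyp2F1_poly_zeros_unit_interval:
  fixes b c :: real
  assumes "0 < c" and "c + real k - 1 < b"
  shows "k \<le> num_zeros_in (hyp2F1_poly k b c) {0<..<1}"
  using assms
proof (induction k arbitrary: b c)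
  case (Suc k)
  have "k \<le> num_zeros_in (hyp2F1_poly k (b + 1) (c + 1)) {0<..<1}"
    using Suc.prems by (intro Suc.IH) auto
  moreover have "c \<notin> lower_nonpos_ints (Suc k)"
    using Suc.prems by (auto simp: lower_nonpos_ints_def)
  ultimately show ?case
    using hyp2F1_poly_Rolle(2)[of c k b] Suc.prems by simp
qed simp

section \<open>Value at 1, zeros outside [0,1] and the degree count\<close>

text \<open>Chu-Vandermonde; it serves both the sign at 1 and Pfaff's transformation.\<close>

lemma poly_hyp2F1_poly_1:
  fixes b c :: real
  assumes "c \<notin> lower_nonpos_ints n"
  shows "poly (hyp2F1_poly n b c) 1 = pochhammer (c - b) n / pochhammer c n"
proof -
  have "\<forall>i\<in>{0..<n}. c \<noteq> - of_nat i" using assms by (auto simp: lower_nonpos_ints_def)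
  from Vandermonde_pochhammer[OF this, of b] show ?thesis
    by (simp add: poly_hyp2F1_poly atLeast0AtMost mult.commute)
qed

text \<open>Far to the right \<open>p\<close> has the sign of its leading coefficient, so the
  intermediate value theorem applies; the negative case passes to \<open>- p\<close>.\<close>

lemma poly_zero_right:
  fixes p :: "real poly"
  assumes "poly p a * lead_coeff p < 0"
  shows "\<exists>x>a. poly p x = 0"
proof -
  have *: "\<exists>x>a. poly p x = 0" if p: "0 < lead_coeff p" "poly p a < 0" for p :: "real poly"
  proof -
    obtain N where "\<forall>x\<ge>N. lead_coeff p \<le> poly p x" using poly_pinfty_gt_lc[OF p(1)] by blast
    then have "0 < poly p (max N (a + 1))" using p(1) by (meson max.cobounded1 order_less_le_trans)
    with p(2) show ?thesis using poly_IVT_pos[of a "max N (a + 1)" p] by fastforce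
  qed
  show ?thesis
  proof (cases "0 < lead_coeff p")
    case True
    then show ?thesis using assms * by (simp add: mult_less_0_iff)
  next
    case False
    then show ?thesis using assms *[of "- p"] by (auto simp: mult_less_0_iff)
  qed
qed

lemma poly_zero_left:
  fixes p :: "real poly"
  assumes "poly p a * ((-1) ^ degree p * lead_coeff p) < 0"
  shows "\<exists>x<a. poly p x = 0"
proof -
  let ?q = "pcompose p [:0, -1:]"
  have "lead_coeff ?q = (-1) ^ degree p * lead_coeff p"
    by (subst lead_coeff_comp) auto
  then obtain x where "- a < x" "poly ?q x = 0"
    using poly_zero_right[of ?q "- a"] assms by (auto simp: poly_pcompose)
  then show ?thesis by (intro exI[of _ "- x"]) (auto simp: poly_pcompose)
qed

text \<open>The lower bounds add up to the degree, so all are equalities and there are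
  \<open>degree p\<close> distinct real roots. Over the complex numbers these leave no room for a
  nonreal or a multiple root.\<close>

lemma zeros_real_simple_partition:
  assumes "p \<noteq> 0" "degree p = i + j + k"
    and "i \<le> num_zeros_in p A" "j \<le> num_zeros_in p B" "k \<le> num_zeros_in p C"
    and "A \<inter> B = {}" "A \<inter> C = {}" "B \<inter> C = {}"
  shows "zeros_real_simple p \<and> num_zeros_in p A = i \<and> num_zeros_in p B = j \<and> num_zeros_in p C = k"
proof -
  let ?Z = "\<lambda>S. {x \<in> S. poly p x = 0}" and ?R = "{x. poly p x = 0}"
  have fin: "finite ?R" using poly_roots_finite[OF assms(1)] .
  then have finS: "finite (?Z S)" for S by (rule rev_finite_subset) auto
  have "card (?Z A \<union> ?Z B \<union> ?Z C) = num_zeros_in p A + num_zeros_in p B + num_zeros_in p C"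
    unfolding num_zeros_in_def using finS assms(6-8)
    by (subst card_Un_disjoint; (subst card_Un_disjoint)?; blast?)
  moreover have "card (?Z A \<union> ?Z B \<union> ?Z C) \<le> card ?R"
    by (rule card_mono[OF fin]) auto
  moreover have "card ?R \<le> degree p" using card_poly_roots_bound[OF assms(1)] .
  ultimately have num: "num_zeros_in p A = i" "num_zeros_in p B = j" "num_zeros_in p C = k"
    and R: "card ?R = degree p"
    using assms(2-5) by linarith+
  define P where "P = map_poly complex_of_real p"
  have P0: "P \<noteq> 0" using assms(1) by (simp add: P_def map_poly_eq_0_iff)
  have eval: "poly P (complex_of_real x) = complex_of_real (poly p x)" for x
    unfolding P_def by (induction p) (simp_all add: map_poly_pCons)
  have card_image: "card (complex_of_real ` ?R) = degree P"
    using R by (simp add: P_def card_image inj_on_def degree_map_poly)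
  have roots: "complex_of_real ` ?R = {z. poly P z = 0}"
  proof (rule card_seteq[OF poly_roots_finite[OF P0]])
    show "complex_of_real ` ?R \<subseteq> {z. poly P z = 0}" using eval by auto
    show "card {z. poly P z = 0} \<le> card (complex_of_real ` ?R)"
      unfolding card_image by (rule card_poly_roots_bound[OF P0])
  qed
  then have cardP: "card {z. poly P z = 0} = degree P" using card_image by simp
  have pos: "0 < order z P" if "poly P z = 0" for z
    using that P0 by (simp add: order_gt_0_iff)
  have "order z P = 1" if z: "poly P z = 0" for z
  proof (rule ccontr)
    assume "order z P \<noteq> 1"
    then have "1 < order z P" using pos[OF z] by linarith
    \<comment> \<open>One order above 1 would make the sum of the orders exceed the number of roots,
      which is already the degree.\<close>
    then have "(\<Sum>w\<in>{w. poly P w = 0}. 1) < (\<Sum>w\<in>{w. poly P w = 0}. order w P)"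
      using z pos poly_roots_finite[OF P0] by (intro sum_strict_mono_ex1) (auto simp: Suc_le_eq)
    also have "\<dots> = size (proots P)"
      unfolding size_multiset_overloaded_eq set_count_proots[OF P0]
      by (rule sum.cong) (simp_all add: P0)
    also have "\<dots> \<le> degree P" by (rule size_proots_le)
    finally show False unfolding cardP[symmetric] by simp
  qed
  moreover have "z \<in> \<real>" if "poly P z = 0" for z
  proof -
    have "z \<in> complex_of_real ` ?R" unfolding roots using that by simp
    then show ?thesis by auto
  qed
  ultimately have "zeros_real_simple p"
    unfolding zeros_real_simple_def P_def[symmetric] by blast
  with num show ?thesis by blast
qed

text \<open>Only the first factor is negative.\<close>

lemma pochhammer_neg:
  fixes a :: real
  assumes "-1 < a" "a < 0" "0 < n"
  shows "pochhammer a n < 0"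
proof -
  obtain m where n: "n = Suc m" using assms(3) gr0_implies_Suc by blast
  have "0 < pochhammer (a + 1) m" by (rule pochhammer_pos) (use assms in simp)
  then show ?thesis using assms by (simp add: n pochhammer_rec mult_neg_pos)
qed

section \<open>Lower bounds in case (i)\<close>

lemma hyp2F1_poly_zeros_ge:
  fixes b c :: real
  assumes n: "n \<ge> 2" and c: "-1 < c" "c < 0"
    and b: "c + real n - 2 < b" "b < c + real n - 1" "0 < b"
  defines "F \<equiv> hyp2F1_poly n b c"
  shows "n - 2 \<le> num_zeros_in F {0<..<1} \<and> 1 \<le> num_zeros_in F {1<..} \<and> 1 \<le> num_zeros_in F {..<0}"
proof -
  obtain m where m: "n = Suc m" "1 \<le> m" using n by (cases n) auto
  have cn: "c \<notin> lower_nonpos_ints n" and bn: "b \<notin> lower_nonpos_ints n"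
    using c b by (auto simp: lower_nonpos_ints_def)
  have deg: "degree F = n" unfolding F_def by (rule degree_hyp2F1_poly[OF bn cn])
  have cneg: "pochhammer c n < 0" using c n by (intro pochhammer_neg) auto
  have lc: "lead_coeff F = (-1) ^ n * (pochhammer b n / pochhammer c n)"
    unfolding deg unfolding F_def coeff_hyp2F1_poly' pochhammer_same by simp
  have neg: "pochhammer b n / pochhammer c n < 0"
    using cneg b by (intro divide_pos_neg pochhammer_pos) auto
  \<comment> \<open>With \<open>m = n - 1\<close>, the lower bound on \<open>b\<close> gives (c+1) +
    m - 1 < b+1, and \<open>-1 < c\<close> makes c + 1 positive.\<close>
  have "m \<le> num_zeros_in (hyp2F1_poly m (b + 1) (c + 1)) {0<..<1}"
    using c b m by (intro hyp2F1_poly_zeros_unit_interval) auto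
  then have "n - 2 \<le> num_zeros_in F {0<..<1}"
    using hyp2F1_poly_Rolle(1)[of c m b] cn m by (simp add: F_def)
  moreover have "\<exists>x>1. poly F x = 0"
  proof (rule poly_zero_right)
    \<comment> \<open>Reversing the factors gives the base b - c - n + 1, which the two bounds on
      \<open>b\<close> place in (-1,0). The sign (-1)^n then cancels against the one in the leading
      coefficient.\<close>
    have "pochhammer (c - b) n = (-1) ^ n * pochhammer (b - c - real n + 1) n"
      using pochhammer_minus[of "b - c" n] by simp
    moreover have "pochhammer (b - c - real n + 1) n < 0"
      using b n by (intro pochhammer_neg) auto
    ultimately have "poly F 1 * lead_coeff F =
        pochhammer (b - c - real n + 1) n / pochhammer c n * (pochhammer b n / pochhammer c n)"
      and "0 < pochhammer (b - c - real n + 1) n / pochhammer c n"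
      using cneg unfolding lc unfolding F_def poly_hyp2F1_poly_1[OF cn]
      by (simp_all add: divide_neg_neg flip: power_mult_distrib)
    then show "poly F 1 * lead_coeff F < 0" using neg by (metis mult_pos_neg)
  qed
  then have "1 \<le> num_zeros_in F {1<..}"
    using num_zeros_in_ge[of F "{x}" "{1<..}" for x] by (auto simp: F_def)
  moreover have "\<exists>x<0. poly F x = 0"
  proof (rule poly_zero_left)
    have "poly F 0 = 1" by (simp add: F_def poly_0_coeff_0 coeff_hyp2F1_poly')
    then show "poly F 0 * ((-1) ^ degree F * lead_coeff F) < 0"
      using neg unfolding lc unfolding deg by simp
  qed
  then have "1 \<le> num_zeros_in F {..<0}"
    using num_zeros_in_ge[of F "{x}" "{..<0}" for x] by (auto simp: F_def)
  ultimately show ?thesis by blast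
qed

section \<open>Coefficient reversal and Pfaff's transformation\<close>

lemma pochhammer_minus_of_nat:
  "pochhammer (- of_nat n) k = (-1) ^ k * of_nat (n choose k) * (fact k :: real)"
  by (simp add: binomial_gbinomial gbinomial_pochhammer)

lemma coeff_hyp2F1_poly_binomial:
  fixes b c :: real
  shows "coeff (hyp2F1_poly n b c) k = (-1) ^ k * of_nat (n choose k) * (pochhammer b k / pochhammer c k)"
  by (simp add: coeff_hyp2F1_poly' pochhammer_minus_of_nat)

text \<open>The last \<open>k\<close> factors of \<open>pochhammer a n\<close>, negated and in
  reverse order, are those of \<open>pochhammer (1 - a - real n) k\<close>.\<close>

lemma pochhammer_diff:
  fixes a :: real
  assumes "a \<notin> lower_nonpos_ints n" "k \<le> n"
  shows "pochhammer a (n - k) * pochhammer (1 - a - real n) k = (-1) ^ k * pochhammer a n"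
proof -
  have "pochhammer (1 - a - real n) k = (-1) ^ k * pochhammer (a + real (n - k)) k"
    using pochhammer_minus[of "a + real n - 1" k] assms(2) by (simp add: of_nat_diff algebra_simps)
  then show ?thesis
    using pochhammer_product[of "n - k" n a] assms(2) by simp
qed

text \<open>Reversal keeps the binomial coefficients, and \<open>pochhammer_diff\<close> turns the
  ratio at n - k into one at k with the roles of \<open>b\<close> and \<open>c\<close>
  exchanged.\<close>

lemma reflect_hyp2F1_poly:
  fixes b c :: real
  assumes b: "b \<notin> lower_nonpos_ints n" and c: "c \<notin> lower_nonpos_ints n"
  shows "reflect_poly (hyp2F1_poly n b c) =
    smult ((-1) ^ n * (pochhammer b n / pochhammer c n))
      (hyp2F1_poly n (1 - c - real n) (1 - b - real n))" (is "_ = smult ?K ?G")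
proof (rule poly_eqI)
  fix k
  show "coeff (reflect_poly (hyp2F1_poly n b c)) k = coeff (smult ?K ?G) k"
  proof (cases "k \<le> n")
    case False
    then show ?thesis
      by (simp add: coeff_reflect_poly degree_hyp2F1_poly[OF b c] coeff_hyp2F1_poly)
  next
    case True
    note B = pochhammer_diff[OF b True] and C = pochhammer_diff[OF c True]
    have nz: "pochhammer b n \<noteq> 0" "pochhammer c n \<noteq> 0" "pochhammer c (n - k) \<noteq> 0"
      using pochhammer_nonzero b c by auto
    have "pochhammer (1 - b - real n) k \<noteq> 0" using B nz(1) by auto
    then have "pochhammer b (n - k) / pochhammer c (n - k) =
       pochhammer b n / pochhammer c n * (pochhammer (1 - c - real n) k / pochhammer (1 - b - real n) k)"
      using B C nz by (simp add: divide_simps) (metis (no_types, lifting) mult.assoc mult.commute)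
    moreover have "(-1 :: real) ^ (n - k) = (-1) ^ n * (-1) ^ k"
      using True by (simp add: minus_one_power_iff)
    ultimately show ?thesis
      using True by (simp add: coeff_reflect_poly degree_hyp2F1_poly[OF b c] coeff_hyp2F1_poly_binomial
          binomial_symmetric[symmetric])
  qed
qed

text \<open>Trading the product of binomials for (n choose k)(n-k choose j-k) and shifting j by k
  leaves the binomial theorem.\<close>

lemma sum_choose_mult_choose:
  fixes x :: real
  assumes "k \<le> n"
  shows "(\<Sum>j\<le>n. real (n choose j) * real (j choose k) * x ^ j) = real (n choose k) * x ^ k * (1 + x) ^ (n - k)"
proof -
  have "(\<Sum>j\<le>n. real (n choose j) * real (j choose k) * x ^ j)
      = (\<Sum>j\<in>{k..n}. real (n choose j) * real (j choose k) * x ^ j)"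
    by (rule sum.mono_neutral_right) auto
  also have "\<dots> = (\<Sum>j\<in>{k..n}. real (n choose k) * (real ((n - k) choose (j - k)) * x ^ j))"
    by (rule sum.cong) (simp_all add: choose_mult flip: of_nat_mult mult.assoc)
  also have "\<dots> = (\<Sum>i\<le>n - k. real (n choose k) * (real ((n - k) choose i) * x ^ (k + i)))"
    by (rule sum.reindex_bij_witness[of _ "\<lambda>i. k + i" "\<lambda>j. j - k"]) (use assms in auto)
  also have "\<dots> = real (n choose k) * x ^ k * (\<Sum>i\<le>n - k. real ((n - k) choose i) * x ^ i)"
    by (simp add: sum_distrib_left power_add mult_ac)
  also have "(\<Sum>i\<le>n - k. real ((n - k) choose i) * x ^ i) = (x + 1) ^ (n - k)"
    by (simp add: binomial_ring)
  finally show ?thesis by (simp add: add.commute)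
qed

text \<open>Chu-Vandermonde expands the coefficients for c - b in those for b; after exchanging the
  sums, the inner sum is \<open>sum_choose_mult_choose\<close> at -z.\<close>

lemma Pfaff_hyp2F1_poly:
  fixes b c z :: real
  assumes c: "c \<notin> lower_nonpos_ints n" and z: "z \<noteq> 1"
  shows "poly (hyp2F1_poly n (c - b) c) z = (1 - z) ^ n * poly (hyp2F1_poly n b c) (z / (z - 1))"
proof -
  let ?r = "\<lambda>k. pochhammer b k / pochhammer c k"
  have eval: "poly (hyp2F1_poly n b c) x = (\<Sum>k\<le>n. (-1) ^ k * real (n choose k) * (pochhammer b k / pochhammer c k) * x ^ k)"
    for n and b x :: real
    by (simp add: poly_hyp2F1_poly pochhammer_minus_of_nat mult_ac)
  have V: "pochhammer (c - b) j / pochhammer c j = (\<Sum>k\<le>n. (-1) ^ k * real (j choose k) * ?r k)" if "j \<le> n" for j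
  proof -
    have "c \<notin> lower_nonpos_ints j" using c that by (auto simp: lower_nonpos_ints_def)
    from poly_hyp2F1_poly_1[OF this, of b]
    have "pochhammer (c - b) j / pochhammer c j = (\<Sum>k\<le>j. (-1) ^ k * real (j choose k) * ?r k)"
      by (simp add: eval)
    \<comment> \<open>The added terms vanish, as \<open>j choose k = 0\<close> for k > j; a common
      range lets the sums be exchanged.\<close>
    also have "\<dots> = (\<Sum>k\<le>n. (-1) ^ k * real (j choose k) * ?r k)"
      by (rule sum.mono_neutral_left) (use that in auto)
    finally show ?thesis .
  qed
  have "poly (hyp2F1_poly n (c - b) c) z =
      (\<Sum>j\<le>n. \<Sum>k\<le>n. (-1) ^ j * real (n choose j) * ((-1) ^ k * real (j choose k) * ?r k) * z ^ j)"
    unfolding eval by (intro sum.cong refl) (simp add: V sum_distrib_left sum_distrib_right)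
  also have "\<dots> = (\<Sum>k\<le>n. (-1) ^ k * ?r k * (\<Sum>j\<le>n. real (n choose j) * real (j choose k) * (- z) ^ j))"
    by (subst sum.swap) (simp add: sum_distrib_left power_minus[of z] mult_ac)
  also have "\<dots> = (\<Sum>k\<le>n. (1 - z) ^ n * ((-1) ^ k * real (n choose k) * ?r k * (z / (z - 1)) ^ k))"
  proof (rule sum.cong)
    fix k assume "k \<in> {..n}"
    then have k: "k \<le> n" by simp
    have "(1 - z) ^ n = (1 - z) ^ (n - k) * (1 - z) ^ k" using k by (simp flip: power_add)
    moreover have "(1 - z) ^ k * (z / (z - 1)) ^ k = (- z) ^ k"
      using z by (simp add: divide_simps flip: power_mult_distrib) (simp add: algebra_simps)
    ultimately show "(-1) ^ k * ?r k * (\<Sum>j\<le>n. real (n choose j) * real (j choose k) * (- z) ^ j)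
        = (1 - z) ^ n * ((-1) ^ k * real (n choose k) * ?r k * (z / (z - 1)) ^ k)"
      using sum_choose_mult_choose[OF k, of "- z"] by (simp add: mult_ac)
  qed simp
  also have "\<dots> = (1 - z) ^ n * poly (hyp2F1_poly n b c) (z / (z - 1))"
    by (simp add: eval sum_distrib_left)
  finally show ?thesis .
qed

section \<open>The three cases\<close>

text \<open>For \<open>n = 2\<close> the range in (i) admits b < 0. There \<open>F\<close> is
  positive at 0 and 1 with positive leading coefficient, so it cannot have exactly one simple zero
  beyond 1. The clause for \<open>n = 2\<close> excludes this; those in (ii) and (iii) correspond to
  it under the two transformations.\<close>

theorem theorem6:
  fixes n :: nat and b c :: real
  assumes "n \<ge> 2"
    and "b \<notin> lower_nonpos_ints n" and "c \<notin> lower_nonpos_ints n"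
  defines "F \<equiv> hyp2F1_poly n b c"
  shows
    "(-1 < c \<and> c < 0 \<and> c + real n - 2 < b \<and> b < c + real n - 1 \<and> (n = 2 \<longrightarrow> 0 < b) \<longrightarrow>
        zeros_real_simple F \<and> num_zeros_in F {0<..<1} = n - 2 \<and>
        num_zeros_in F {1<..} = 1 \<and> num_zeros_in F {..<0} = 1) \<and>
     (1 - real n < b \<and> b < 2 - real n \<and> b - real n + 1 < c \<and> c < b - real n + 2 \<and>
        (n = 2 \<longrightarrow> c < -1) \<longrightarrow>
        zeros_real_simple F \<and> num_zeros_in F {1<..} = n - 2 \<and>
        num_zeros_in F {..<0} = 1 \<and> num_zeros_in F {0<..<1} = 1) \<and>
     (-1 < c \<and> c < 0 \<and> 1 - real n < b \<and> b < 2 - real n \<and> (n = 2 \<longrightarrow> b < c) \<longrightarrow>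
        zeros_real_simple F \<and> num_zeros_in F {..<0} = n - 2 \<and>
        num_zeros_in F {1<..} = 1 \<and> num_zeros_in F {0<..<1} = 1)"
proof -
  have F0: "F \<noteq> 0" by (simp add: F_def)
  have deg: "degree F = n - 2 + 1 + 1"
    using assms(1) degree_hyp2F1_poly[OF assms(2,3)] by (simp add: F_def)
  show ?thesis
  proof (intro conjI[of "_ \<longrightarrow> _"] impI)
    assume *: "-1 < c \<and> c < 0 \<and> c + real n - 2 < b \<and> b < c + real n - 1 \<and> (n = 2 \<longrightarrow> 0 < b)"
    \<comment> \<open>For n at least 3, b > c + n - 2 > n - 3 gives positivity.\<close>
    then have "0 < b" using assms(1) by (cases "n = 2") auto
    with * show "zeros_real_simple F \<and> num_zeros_in F {0<..<1} = n - 2 \<and>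
        num_zeros_in F {1<..} = 1 \<and> num_zeros_in F {..<0} = 1"
      using hyp2F1_poly_zeros_ge[OF assms(1), of c b]
      by (intro zeros_real_simple_partition[OF F0 deg]) (auto simp: F_def)
  next
    assume *: "1 - real n < b \<and> b < 2 - real n \<and> b - real n + 1 < c \<and> c < b - real n + 2 \<and>
        (n = 2 \<longrightarrow> c < -1)"
    \<comment> \<open>The map sending (b, c) to (1-c-n, 1-b-n) carries the range of (ii) to that of
      (i); inversion swaps (0,1) with the ray beyond 1 and preserves the negative axis.\<close>
    define G where "G = hyp2F1_poly n (1 - c - real n) (1 - b - real n)"
    have pos: "0 < 1 - c - real n" using * assms(1) by (cases "n = 2") auto
    have G: "n - 2 \<le> num_zeros_in G {0<..<1} \<and> 1 \<le> num_zeros_in G {1<..} \<and> 1 \<le> num_zeros_in G {..<0}"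
      unfolding G_def by (rule hyp2F1_poly_zeros_ge[OF assms(1)]) (use * pos in auto)
    have zero: "poly F (inverse x) = 0" if "poly G x = 0" "x \<noteq> 0" for x
      using arg_cong[OF reflect_hyp2F1_poly[OF assms(2,3)], of "\<lambda>p. poly p x"] that
      by (simp add: poly_reflect_poly_nz F_def G_def)
    have le: "num_zeros_in G S \<le> num_zeros_in F T" if "\<And>x. x \<in> S \<Longrightarrow> x \<noteq> 0 \<and> inverse x \<in> T" for S T
      by (rule num_zeros_in_mono[OF F0, of inverse]) (use that zero in \<open>auto simp: inj_on_def\<close>)
    have "num_zeros_in G {0<..<1} \<le> num_zeros_in F {1<..}" by (rule le) (auto simp: one_less_inverse)
    moreover have "num_zeros_in G {1<..} \<le> num_zeros_in F {0<..<1}" by (rule le) (auto simp: inverse_less_1_iff)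
    moreover have "num_zeros_in G {..<0} \<le> num_zeros_in F {..<0}" by (rule le) auto
    ultimately show "zeros_real_simple F \<and> num_zeros_in F {1<..} = n - 2 \<and>
        num_zeros_in F {..<0} = 1 \<and> num_zeros_in F {0<..<1} = 1"
      using G by (intro zeros_real_simple_partition[OF F0 deg]) auto
  next
    assume *: "-1 < c \<and> c < 0 \<and> 1 - real n < b \<and> b < 2 - real n \<and> (n = 2 \<longrightarrow> b < c)"
    \<comment> \<open>Replacing b by c - b carries the range of (iii) to that of (i); x/(x-1) swaps
      (0,1) with the negative axis and preserves the ray beyond 1.\<close>
    define G where "G = hyp2F1_poly n (c - b) c"
    have pos: "0 < c - b" using * assms(1) by (cases "n = 2") auto
    have G: "n - 2 \<le> num_zeros_in G {0<..<1} \<and> 1 \<le> num_zeros_in G {1<..} \<and> 1 \<le> num_zeros_in G {..<0}"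
      unfolding G_def by (rule hyp2F1_poly_zeros_ge[OF assms(1)]) (use * pos in auto)
    have zero: "poly F (x / (x - 1)) = 0" if "poly G x = 0" "x \<noteq> 1" for x
      using Pfaff_hyp2F1_poly[OF assms(3) that(2), of b] that by (simp add: F_def G_def)
    have le: "num_zeros_in G S \<le> num_zeros_in F T" if "\<And>x. x \<in> S \<Longrightarrow> x \<noteq> 1 \<and> x / (x - 1) \<in> T" for S T
      by (rule num_zeros_in_mono[OF F0, of "\<lambda>x. x / (x - 1)"])
        (use that zero in \<open>auto simp: inj_on_def field_simps\<close>)
    have "num_zeros_in G {0<..<1} \<le> num_zeros_in F {..<0}" by (rule le) (auto simp: divide_simps)
    moreover have "num_zeros_in G {1<..} \<le> num_zeros_in F {1<..}" by (rule le) (auto simp: divide_simps)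
    moreover have "num_zeros_in G {..<0} \<le> num_zeros_in F {0<..<1}" by (rule le) (auto simp: divide_simps)
    ultimately show "zeros_real_simple F \<and> num_zeros_in F {..<0} = n - 2 \<and>
        num_zeros_in F {1<..} = 1 \<and> num_zeros_in F {0<..<1} = 1"
      using G by (intro zeros_real_simple_partition[OF F0 deg]) auto
  qed
qed

end
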